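(* Let $f:\mathbb{R}^d\to\mathbb{R}\cup\{\infty\}$ be $\ell$-smooth. Then for all $x,y\in\mathcal{X}$ such that $\|y-x\|\in[0,q_{\max}(\|\nabla f(x)\|))$, $$\|\nabla f(y)-\nabla f(x)\|\le q^{-1}(\|y-x\|;\|\nabla f(x)\|).$$
   Context: Norms are Euclidean for vectors and spectral for matrices. For $f:\mathbb{R}^d\to\mathbb{R}\cup\{\infty\}$ put $\mathcal{X}=\{x\in\mathbb{R}^d: f(x)<\infty\}$, assumed to be open and convex. $f$ is $\ell$-smooth if $f$ is twice differentiable on $\mathcal{X}$, $f$ is continuous on the closure of $\mathcal{X}$ (as a map into $\mathbb{R}\cup\{\infty\}$), and $\ell:[0,\infty)\to(0,\infty)$ is a non-decreasing positive locally Lipschitz function such that $\|\nabla^2f(x)\|\le\ell(\|\nabla f(x)\|)$ for all $x\in\mathcal{X}$. For $a\ge0$ define $q(s;a)=\int_0^s\frac{dv}{\ell(a+v)}$ for $s\ge0$ and $q_{\max}(a)=\int_0^\infty\frac{dv}{\ell(a+v)}\in(0,\infty]$. For fixed $a$, $q(\cdot;a)$ is a strictly increasing bijection $[0,\infty)\to[0,q_{\max}(a))$, and $q^{-1}(\cdot;a):[0,q_{\max}(a))\to[0,\infty)$ denotes its inverse. *)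

theory Defs
  imports "HOL-Analysis.Analysis"
begin

text \<open>
  A function into $R \cup \{\infty\}$ is an \<^typ>\<open>ereal\<close>-valued function that never takes the
  value \<open>-\<infinity>\<close>.
\<close>

definition eff_dom :: "('a \<Rightarrow> ereal) \<Rightarrow> 'a set"
  where "eff_dom f = {x. f x < \<infinity>}"

text \<open>
  The gradient and the Hessian are taken of the real-valued function obtained with
  \<^const>\<open>real_of_ereal\<close>. They are meaningful only at interior points of
  the effective domain of \<open>f\<close>, where this function agrees with \<open>f\<close> on a neighbourhood.
\<close>

definition gradient :: "(real ^ 'n \<Rightarrow> ereal) \<Rightarrow> real ^ 'n \<Rightarrow> real ^ 'n"
  where "gradient f x = (THE D. GDERIV (\<lambda>z. real_of_ereal (f z)) x :> D)"

definition hessian :: "(real ^ 'n \<Rightarrow> ereal) \<Rightarrow> real ^ 'n \<Rightarrow> real ^ 'n ^ 'n"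
  where "hessian f x = jacobian (gradient f) (at x)"

definition twice_differentiable_at :: "(real ^ 'n \<Rightarrow> ereal) \<Rightarrow> real ^ 'n \<Rightarrow> bool"
  where "twice_differentiable_at f x \<longleftrightarrow>
    (\<forall>\<^sub>F z in nhds x. (\<lambda>z. real_of_ereal (f z)) differentiable (at z)) \<and>
    gradient f differentiable (at x)"

text \<open>\<^const>\<open>onorm\<close> is the operator norm induced by the Euclidean norms.\<close>

definition spectral_norm :: "real ^ 'n ^ 'm \<Rightarrow> real"
  where "spectral_norm A = onorm (\<lambda>v. A *v v)"

text \<open>
  Only the values of \<open>l\<close> on \<open>[0,\<infinity>)\<close> matter. The library's \<^const>\<open>local_lipschitz\<close> is stated for
  families of functions; here the family is constant, indexed by a single dummy parameter.
\<close>

definition ell_smooth :: "(real \<Rightarrow> real) \<Rightarrow> (real ^ 'n \<Rightarrow> ereal) \<Rightarrow> bool"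
  where "ell_smooth l f \<longleftrightarrow>
    (\<forall>x \<in> eff_dom f. twice_differentiable_at f x) \<and>
    continuous_on (closure (eff_dom f)) f \<and>
    (\<forall>s \<ge> 0. l s > 0) \<and>
    mono_on {0..} l \<and>
    local_lipschitz {0::real} {0..} (\<lambda>_. l) \<and>
    (\<forall>x \<in> eff_dom f. spectral_norm (hessian f x) \<le> l (norm (gradient f x)))"

definition q :: "(real \<Rightarrow> real) \<Rightarrow> real \<Rightarrow> real \<Rightarrow> real"
  where "q l s a = integral {0..s} (\<lambda>v. 1 / l (a + v))"

definition q_max :: "(real \<Rightarrow> real) \<Rightarrow> real \<Rightarrow> ennreal"
  where "q_max l a = (\<integral>\<^sup>+ v \<in> {0..}. ennreal (1 / l (a + v)) \<partial>lborel)"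

text \<open>The value \<open>q_inv l r a\<close> is meaningful only for \<open>0 \<le> r\<close> and \<open>ennreal r < q_max l a\<close>.\<close>

definition q_inv :: "(real \<Rightarrow> real) \<Rightarrow> real \<Rightarrow> real \<Rightarrow> real"
  where "q_inv l r a = inv_into {0..} (\<lambda>s. q l s a) r"

end

theory Submission
  imports Defs
begin

text \<open>
  Write \<open>a = \<parallel>\<nabla>f(x)\<parallel>\<close>, \<open>r = \<parallel>y - x\<parallel>\<close> and follow the gradient along the segment from \<open>x\<close> to \<open>y\<close>:
  let \<open>g(t) = \<nabla>f(x + t(y - x))\<close> and \<open>s(t) = \<parallel>g(t) - g(0)\<parallel>\<close>. The Hessian bound, the monotonicity of
  \<open>l\<close> and the triangle inequality give \<open>\<parallel>g'(t)\<parallel> \<le> r l(\<parallel>g(t)\<parallel>) \<le> r l(a + s(t))\<close>. As \<open>q(\<cdot>; a)\<close> has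
  derivative \<open>1 / l(a + \<cdot>)\<close>, the chain rule bounds the derivative of \<open>q(s(t); a)\<close> by \<open>r\<close> wherever
  \<open>s\<close> is differentiable, and so \<open>q(s(1); a) \<le> r\<close> (\<open>q_norm_increment_le\<close>).

  It remains to invert \<open>q(\<cdot>; a)\<close>. It is strictly increasing, and by monotone convergence every
  \<open>r < q_max(a)\<close> is exceeded by one of its values (\<open>q_exceeds_below_q_max\<close>), so
  by the intermediate value theorem \<open>r\<close> is a value of \<open>q(\<cdot>; a)\<close>, attained at \<open>q_inv(r; a)\<close> only, and \<open>q(s(1); a) \<le> r\<close> means
  \<open>s(1) \<le> q_inv(r; a)\<close> (\<open>le_q_inv\<close>).

  The mean value theorem turns the bound on the derivative into a bound on the increment without
  any continuity of the Hessian, hence of \<open>g'\<close>.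
\<close>

lemma continuous_on_inverse_shift:
  fixes l :: "real \<Rightarrow> real"
  assumes "continuous_on {0..} l" and "\<And>s. 0 \<le> s \<Longrightarrow> 0 < l s" and "0 \<le> a"
  shows "continuous_on {0..} (\<lambda>v. 1 / l (a + v))"
proof -
  have "continuous_on {0..} (\<lambda>v. l (a + v))"
    by (rule continuous_on_compose2[OF assms(1)]) (use assms(3) in \<open>auto intro!: continuous_intros\<close>)
  moreover have "l (a + v) \<noteq> 0" if "v \<in> {0..}" for v
    using assms(2)[of "a + v"] assms(3) that by auto
  ultimately show ?thesis
    by (auto intro!: continuous_intros)
qed

lemma continuous_on_q:
  assumes "continuous_on {0..} (\<lambda>v. 1 / l (a + v))"
  shows "continuous_on {0..b} (\<lambda>s. q l s a)"
  unfolding q_def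
  by (intro indefinite_integral_continuous_1 integrable_continuous_real
      continuous_on_subset[OF assms]) auto

lemma has_real_derivative_q:
  assumes "continuous_on {0..} (\<lambda>v. 1 / l (a + v))" and "0 < s"
  shows "((\<lambda>s. q l s a) has_real_derivative 1 / l (a + s)) (at s)"
proof -
  have "((\<lambda>s. q l s a) has_vector_derivative 1 / l (a + s)) (at s within {0..s+1})"
    unfolding q_def
    by (rule integral_has_vector_derivative[OF continuous_on_subset[OF assms(1)]])
       (use assms(2) in auto)
  moreover have "at s within {0..s+1} = at s"
    using assms(2) by (intro at_within_interior) auto
  ultimately show ?thesis
    by (simp add: has_real_derivative_iff_has_vector_derivative)
qed

lemma q_strict_mono:
  assumes "continuous_on {0..} (\<lambda>v. 1 / l (a + v))" and "\<And>v. 0 \<le> v \<Longrightarrow> 0 < l (a + v)"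
    and "0 \<le> s" and "s < t"
  shows "q l s a < q l t a"
proof (rule DERIV_pos_imp_increasing_open[OF \<open>s < t\<close>])
  show "\<exists>D. ((\<lambda>s. q l s a) has_real_derivative D) (at u) \<and> 0 < D" if "s < u" "u < t" for u
    using has_real_derivative_q[OF assms(1), of u] assms(2)[of u] assms(3) that by fastforce
  show "continuous_on {s..t} (\<lambda>s. q l s a)"
    by (rule continuous_on_subset[OF continuous_on_q[OF assms(1), where b = t]]) (use assms(3) in auto)
qed

text \<open>The integral defining \<open>q_max\<close> is the supremum of those over \<open>[0, n]\<close>, which are \<open>q l n a\<close>.\<close>

lemma q_exceeds_below_q_max:
  assumes cont: "continuous_on {0..} (\<lambda>v. 1 / l (a + v))"
    and pos: "\<And>v. 0 \<le> v \<Longrightarrow> 0 < l (a + v)"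
    and "0 \<le> r" and "ennreal r < q_max l a"
  obtains n :: nat where "r < q l (real n) a"
proof -
  let ?h = "\<lambda>v. 1 / l (a + v)"
  let ?F = "\<lambda>(n::nat) v. ennreal (?h v) * indicator {0..real n} v"
  have meas: "(\<lambda>v. ?F n v) \<in> borel_measurable lborel" for n
  proof -
    have "(\<lambda>v. indicator {0..real n} v *\<^sub>R ?h v) \<in> borel_measurable borel"
      by (rule borel_measurable_continuous_on_indicator[OF _ continuous_on_subset[OF cont]]) auto
    hence "(\<lambda>v. ennreal (indicator {0..real n} v *\<^sub>R ?h v)) \<in> borel_measurable lborel"
      by measurable
    also have "(\<lambda>v. ennreal (indicator {0..real n} v *\<^sub>R ?h v)) = ?F n"
      by (auto simp: indicator_def)
    finally show ?thesis .
  qed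
  have inc: "incseq ?F"
    by (auto simp: incseq_def le_fun_def indicator_def)
  have sup: "(SUP n. ?F n v) = ennreal (?h v) * indicator {0..} v" for v
  proof (rule antisym)
    show "(SUP n. ?F n v) \<le> ennreal (?h v) * indicator {0..} v"
      by (rule SUP_least) (auto simp: indicator_def)
    obtain n :: nat where "v \<le> real n"
      using real_arch_simple by blast
    hence "ennreal (?h v) * indicator {0..} v = ?F n v"
      by (auto simp: indicator_def)
    also have "\<dots> \<le> (SUP n. ?F n v)"
      by (rule SUP_upper) simp
    finally show "ennreal (?h v) * indicator {0..} v \<le> (SUP n. ?F n v)" .
  qed
  have "q_max l a = (\<integral>\<^sup>+ v. (SUP n. ?F n v) \<partial>lborel)"
    unfolding q_max_def sup ..
  also have "\<dots> = (SUP n. \<integral>\<^sup>+ v. ?F n v \<partial>lborel)"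
    using nn_integral_monotone_convergence_SUP[OF inc meas] by simp
  finally obtain n where n: "ennreal r < (\<integral>\<^sup>+ v. ?F n v \<partial>lborel)"
    using assms(4) by (auto simp: less_SUP_iff)
  have cont_n: "continuous_on {0..real n} ?h"
    by (rule continuous_on_subset[OF cont]) auto
  have "(\<integral>\<^sup>+ v. ?F n v \<partial>lborel) = ennreal (q l (real n) a)"
  proof -
    have "(\<integral>\<^sup>+ v. ?F n v \<partial>lborel) = (\<integral>\<^sup>+ v. ennreal (indicator {0..real n} v *\<^sub>R ?h v) \<partial>lborel)"
      by (intro nn_integral_cong) (auto simp: indicator_def)
    also have "\<dots> = ennreal (\<integral>v. indicator {0..real n} v *\<^sub>R ?h v \<partial>lborel)"
      using borel_integrable_atLeastAtMost'[OF cont_n] pos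
      by (intro nn_integral_eq_integral) (auto simp: set_integrable_def indicator_def less_imp_le)
    also have "(\<integral>v. indicator {0..real n} v *\<^sub>R ?h v \<partial>lborel) = q l (real n) a"
      using set_borel_integral_eq_integral(2)[OF borel_integrable_atLeastAtMost'[OF cont_n]]
      by (simp add: q_def set_lebesgue_integral_def)
    finally show ?thesis .
  qed
  with n have "r < q l (real n) a"
    using \<open>0 \<le> r\<close> by (simp add: ennreal_less_iff)
  thus thesis ..
qed

text \<open>
  A comparison principle for the differential inequality \<open>\<parallel>g'\<parallel> \<le> r l(a + \<parallel>g - g(0)\<parallel>)\<close>. The norm is
  not differentiable at \<open>0\<close>, so the mean value theorem for \<open>q(\<parallel>g(t) - g(0)\<parallel>; a)\<close> is applied only
  after the last time at which \<open>g\<close> equals \<open>g(0)\<close>.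
\<close>

lemma q_norm_increment_le:
  fixes g :: "real \<Rightarrow> 'a::real_inner"
  assumes cont: "continuous_on {0..} (\<lambda>v. 1 / l (a + v))"
    and pos: "\<And>v. 0 \<le> v \<Longrightarrow> 0 < l (a + v)"
    and g_cont: "continuous_on {0..1} g"
    and g_deriv: "\<And>t. 0 < t \<Longrightarrow> t < 1 \<Longrightarrow> (g has_vector_derivative g' t) (at t)"
    and g_bound: "\<And>t. 0 < t \<Longrightarrow> t < 1 \<Longrightarrow> norm (g' t) \<le> r * l (a + norm (g t - g 0))"
    and "0 \<le> r"
  shows "q l (norm (g 1 - g 0)) a \<le> r"
proof (cases "g 1 = g 0")
  case True
  thus ?thesis using \<open>0 \<le> r\<close> by (simp add: q_def)
next
  case False
  let ?s = "\<lambda>t. norm (g t - g 0)"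
  let ?Z = "{t \<in> {0..1}. ?s t = 0}"
  have s_cont: "continuous_on {0..1} ?s"
    by (intro continuous_intros g_cont)
  have "closed ?Z"
    by (intro continuous_closed_preimage_constant s_cont) auto
  moreover have "bounded ?Z"
    by (rule bounded_subset[OF bounded_closed_interval[of 0 1]]) auto
  ultimately have "compact ?Z"
    by (simp add: compact_eq_bounded_closed)
  moreover have "0 \<in> ?Z" by simp
  ultimately obtain c where c: "c \<in> ?Z" and c_last: "\<And>t. t \<in> ?Z \<Longrightarrow> t \<le> c"
    using compact_attains_sup[of ?Z] by blast
  have "0 \<le> c" "c < 1" using c False by (auto simp: less_le)
  have s_pos: "0 < ?s t" if "c < t" "t < 1" for t
  proof -
    have "t \<notin> ?Z" using c_last[of t] that by linarith
    thus ?thesis using that \<open>0 \<le> c\<close> by simp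
  qed
  define D where "D = (\<lambda>t. (1 / l (a + ?s t)) * (g' t \<bullet> sgn (g t - g 0)))"
  have comp_deriv: "((\<lambda>t. q l (?s t) a) has_real_derivative D t) (at t)" if "c < t" "t < 1" for t
  proof -
    have "((\<lambda>t. g t - g 0) has_derivative (\<lambda>u. u *\<^sub>R g' t)) (at t)"
      using g_deriv[of t] that \<open>0 \<le> c\<close>
      by (auto simp: has_vector_derivative_def intro!: derivative_eq_intros)
    hence "(?s has_derivative (\<lambda>u. (u *\<^sub>R g' t) \<bullet> sgn (g t - g 0))) (at t)"
      by (rule has_derivative_compose)
         (use has_derivative_norm[of "g t - g 0"] s_pos[OF that] in auto)
    hence "(?s has_real_derivative (g' t \<bullet> sgn (g t - g 0))) (at t)"
      by (rule has_derivative_imp_has_field_derivative) simp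
    from DERIV_chain2[OF has_real_derivative_q[OF cont s_pos[OF that]] this]
    show ?thesis by (simp add: D_def)
  qed
  have D_le: "D t \<le> r" if "c < t" "t < 1" for t
  proof -
    have "g' t \<bullet> sgn (g t - g 0) \<le> norm (g' t) * norm (sgn (g t - g 0))"
      by (rule norm_cauchy_schwarz)
    also have "\<dots> \<le> r * l (a + ?s t)"
      using g_bound[of t] s_pos[OF that] that \<open>0 \<le> c\<close> by (simp add: norm_sgn)
    finally show ?thesis
      using pos[of "?s t"] by (simp add: D_def field_simps)
  qed
  have "continuous_on {c..1} (\<lambda>t. q l (?s t) a)"
  proof -
    have sc: "continuous_on {c..1} ?s"
      by (rule continuous_on_subset[OF s_cont]) (use \<open>0 \<le> c\<close> in auto)
    obtain B where "\<And>t. t \<in> {c..1} \<Longrightarrow> ?s t \<le> B"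
      using compact_continuous_image[OF sc compact_Icc, THEN compact_imp_bounded]
      by (fastforce simp: bounded_iff)
    hence "?s ` {c..1} \<subseteq> {0..B}" by auto
    from continuous_on_compose2[OF continuous_on_q[OF cont] sc this] show ?thesis .
  qed
  then obtain z where z: "c < z" "z < 1"
    and "q l (?s 1) a - q l (?s c) a = (1 - c) * D z"
    using MVT[of c 1 "\<lambda>t. q l (?s t) a"] \<open>c < 1\<close> comp_deriv
    by (metis real_differentiable_def DERIV_unique)
  moreover have "q l (?s c) a = 0" using c by (simp add: q_def)
  ultimately have "q l (?s 1) a = (1 - c) * D z" by simp
  also have "\<dots> \<le> (1 - c) * r"
    using D_le[OF z] \<open>c < 1\<close> by (intro mult_left_mono) auto
  also have "\<dots> \<le> r"
    using \<open>0 \<le> c\<close> \<open>0 \<le> r\<close> by (simp add: mult_left_le_one_le algebra_simps)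
  finally show ?thesis .
qed

lemma le_q_inv:
  assumes cont: "continuous_on {0..} (\<lambda>v. 1 / l (a + v))"
    and pos: "\<And>v. 0 \<le> v \<Longrightarrow> 0 < l (a + v)"
    and "0 \<le> r" and "ennreal r < q_max l a"
    and "0 \<le> s" and "q l s a \<le> r"
  shows "s \<le> q_inv l r a"
proof -
  obtain n :: nat where n: "r < q l (real n) a"
    using q_exceeds_below_q_max[OF cont pos assms(3,4)] by blast
  have "\<exists>w. 0 \<le> w \<and> w \<le> real n \<and> q l w a = r"
    by (rule IVT') (use n \<open>0 \<le> r\<close> continuous_on_q[OF cont] in \<open>auto simp: q_def\<close>)
  then obtain w where w: "0 \<le> w" "q l w a = r" by blast
  have "strict_mono_on {0..} (\<lambda>s. q l s a)"
    using q_strict_mono[where l = l and a = a, OF cont pos] by (auto intro!: strict_mono_onI)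
  hence "q_inv l r a = w"
    unfolding q_inv_def using w by (auto intro!: inv_into_f_eq strict_mono_on_imp_inj_on)
  moreover have "s \<le> w"
    using q_strict_mono[where l = l and a = a, OF cont pos w(1), of s] assms(6) w(2) by linarith
  ultimately show ?thesis by simp
qed

lemma ell_smooth_gradient_has_derivative:
  assumes "ell_smooth l f" and "z \<in> eff_dom f"
  shows "(gradient f has_derivative (\<lambda>h. hessian f z *v h)) (at z)"
  using assms by (simp add: ell_smooth_def twice_differentiable_at_def hessian_def
      jacobian_works[symmetric])

lemma ell_smooth_norm_hessian_le:
  assumes "ell_smooth l f" and "z \<in> eff_dom f"
  shows "norm (hessian f z *v h) \<le> norm h * l (norm (gradient f z))"
proof -
  have "norm (hessian f z *v h) \<le> spectral_norm (hessian f z) * norm h"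
    unfolding spectral_norm_def by (rule onorm) simp
  also have "\<dots> \<le> l (norm (gradient f z)) * norm h"
    using assms by (intro mult_right_mono) (auto simp: ell_smooth_def)
  finally show ?thesis by (simp add: mult.commute)
qed

theorem lemma4p3:
  fixes f :: "real ^ 'n \<Rightarrow> ereal" and l :: "real \<Rightarrow> real" and x y :: "real ^ 'n"
  assumes "\<And>z. f z \<noteq> -\<infinity>"
    and "open (eff_dom f)" and "convex (eff_dom f)"
    and "ell_smooth l f"
    and "x \<in> eff_dom f" and "y \<in> eff_dom f"
    and "ennreal (norm (y - x)) < q_max l (norm (gradient f x))"
  shows "norm (gradient f y - gradient f x) \<le> q_inv l (norm (y - x)) (norm (gradient f x))"
proof -
  let ?a = "norm (gradient f x)" and ?r = "norm (y - x)"
  have l_pos: "\<And>s. 0 \<le> s \<Longrightarrow> 0 < l s" and l_mono: "mono_on {0..} l"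
    and "local_lipschitz {0::real} {0..} (\<lambda>_. l)"
    using assms(4) by (auto simp: ell_smooth_def)
  hence "continuous_on {0..} l"
    by (auto intro: local_lipschitz_continuous_on)
  hence cont: "continuous_on {0..} (\<lambda>v. 1 / l (?a + v))"
    by (intro continuous_on_inverse_shift l_pos) auto
  have pos: "0 < l (?a + v)" if "0 \<le> v" for v
    by (rule l_pos) (use that in simp)
  define p where "p = (\<lambda>t. x + t *\<^sub>R (y - x))"
  define g where "g = (\<lambda>t. gradient f (p t))"
  have p_dom: "p t \<in> eff_dom f" if "0 \<le> t" "t \<le> 1" for t
    using convexD_alt[OF assms(3,5,6) that] by (simp add: p_def algebra_simps)
  have g_deriv: "(g has_vector_derivative hessian f (p t) *v (y - x)) (at t)"
    if "0 \<le> t" "t \<le> 1" for t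
  proof -
    have "(p has_derivative (\<lambda>u. u *\<^sub>R (y - x))) (at t)"
      unfolding p_def by (auto intro!: derivative_eq_intros)
    from has_derivative_compose[OF this
        ell_smooth_gradient_has_derivative[OF assms(4) p_dom[OF that]]]
    show ?thesis
      by (simp add: g_def has_vector_derivative_def matrix_vector_mult_scaleR)
  qed
  have "q l (norm (g 1 - g 0)) ?a \<le> ?r"
  proof (rule q_norm_increment_le[OF cont pos])
    show "continuous_on {0..1} g"
      using has_vector_derivative_continuous[OF g_deriv]
      by (intro continuous_at_imp_continuous_on) auto
    show "(g has_vector_derivative hessian f (p t) *v (y - x)) (at t)" if "0 < t" "t < 1" for t
      using g_deriv[of t] that by simp
    show "norm (hessian f (p t) *v (y - x)) \<le> ?r * l (?a + norm (g t - g 0))"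
      if "0 < t" "t < 1" for t
    proof -
      have "norm (hessian f (p t) *v (y - x)) \<le> ?r * l (norm (g t))"
        unfolding g_def using that
        by (intro ell_smooth_norm_hessian_le[OF assms(4)] p_dom) auto
      also have "\<dots> \<le> ?r * l (?a + norm (g t - g 0))"
        using norm_triangle_sub[of "g t" "g 0"]
        by (intro mult_left_mono mono_onD[OF l_mono]) (auto simp: g_def p_def)
      finally show ?thesis .
    qed
  qed auto
  hence "q l (norm (gradient f y - gradient f x)) ?a \<le> ?r"
    by (simp add: g_def p_def)
  thus ?thesis
    by (intro le_q_inv[OF cont pos] assms(7)) auto
qed

end
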